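(* Let $F$ be an analytic function defined in a neighbourhood of $0\in\mathbb{C}$ such that $F(0)\neq0$, $F'(0)=0$ and $F''(0)\neq0$. Then the Gaussian curvature $K$ of the modular surface in $\mathbb{E}_1^3$ induced by $F$ is positive in a sufficiently small neighbourhood of the origin $z=0$.
   Context: $\mathbb{E}_1^3$ denotes $\mathbb{R}^3$ with the Lorentzian metric $dx^2+dy^2-dt^2$; $(x,y)$ is identified with $z=x+iy$. The modular surface induced by an analytic function $F$ is the graph $(x,y,h(x,y))$ with $h=|F|$. Its Gaussian curvature in $\mathbb{E}_1^3$, as a function of $z$, is $$K=-\frac{h_{xx}h_{yy}-h_{xy}^2}{(1-h_x^2-h_y^2)^2},$$ which where $F\neq0$ and $|F'|\neq1$ equals $-\dfrac{|F'|^4-|2FF''-(F')^2|^2}{4|F|^2(1-|F'|^2)^2}$. $F$ is not required to be the square of an analytic function. *)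

theory Defs
  imports "HOL-Complex_Analysis.Complex_Analysis"
begin

definition partial_x :: "(real \<Rightarrow> real \<Rightarrow> real) \<Rightarrow> real \<Rightarrow> real \<Rightarrow> real" where
  "partial_x h x y = deriv (\<lambda>s. h s y) x"

definition partial_y :: "(real \<Rightarrow> real \<Rightarrow> real) \<Rightarrow> real \<Rightarrow> real \<Rightarrow> real" where
  "partial_y h x y = deriv (\<lambda>t. h x t) y"

(* The Gaussian curvature of the graph (x, y, h(x,y)) for the Lorentzian metric
   dx^2 + dy^2 - dt^2 on R^3.  It is meaningful where h is twice differentiable and
   h_x^2 + h_y^2 is not 1 (where the induced metric is nondegenerate); where
   h_x^2 + h_y^2 = 1, the convention a / 0 = 0 makes this expression 0. *)
definition lorentz_graph_curvature :: "(real \<Rightarrow> real \<Rightarrow> real) \<Rightarrow> real \<Rightarrow> real \<Rightarrow> real" where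
  "lorentz_graph_curvature h x y =
     - ((partial_x (partial_x h) x y * partial_y (partial_y h) x y
          - (partial_y (partial_x h) x y)\<^sup>2)
        / (1 - (partial_x h x y)\<^sup>2 - (partial_y h x y)\<^sup>2)\<^sup>2)"

definition modular_height :: "(complex \<Rightarrow> complex) \<Rightarrow> real \<Rightarrow> real \<Rightarrow> real" where
  "modular_height F x y = cmod (F (Complex x y))"

definition modular_curvature :: "(complex \<Rightarrow> complex) \<Rightarrow> complex \<Rightarrow> real" where
  "modular_curvature F z = lorentz_graph_curvature (modular_height F) (Re z) (Im z)"

end

theory Submission
  imports Defs
begin

text \<open>
  Since \<open>F 0 \<noteq> 0\<close>, the function \<open>F\<close> has a holomorphic square root \<open>G\<close> near the origin, and the
  height becomes a smooth quadratic expression in \<open>G\<close>: \<open>\<bar>F\<bar> = \<bar>G\<bar>\<^sup>2 = G \<bullet> G\<close>, with the real inner product of the plane.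
  Differentiating such inner products by the product rule (\<open>partials_of_inner\<close>), with
  \<open>\<partial>\<^sub>x G = G'\<close> and \<open>\<partial>\<^sub>y G = \<i> G'\<close>, yields
  \<open>K = 4 (\<bar>G G''\<bar>\<^sup>2 - \<bar>G'\<bar>\<^sup>4) / (1 - 4 \<bar>G G'\<bar>\<^sup>2)\<^sup>2\<close> (\<open>modular_curvature_square\<close>).

  From \<open>F' = 2 G G'\<close> and \<open>F'' = 2 (G'\<^sup>2 + G G'')\<close> the hypotheses at the origin say that \<open>G\<close> and \<open>G''\<close>
  do not vanish there, while \<open>G'\<close> does. So at the origin \<open>\<bar>G G''\<bar>\<^sup>2 - \<bar>G'\<bar>\<^sup>4\<close> is positive and
  \<open>1 - 4 \<bar>G G'\<bar>\<^sup>2\<close> equals 1; by continuity both remain positive nearby, and so does \<open>K\<close>.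
\<close>

lemma has_vector_derivative_along_lines:
  assumes "(f has_field_derivative f') (at z)"
  shows "((\<lambda>s. f (Complex s (Im z))) has_vector_derivative f') (at (Re z))"
    and "((\<lambda>t. f (Complex (Re z) t)) has_vector_derivative \<i> * f') (at (Im z))"
proof -
  have "((\<lambda>s. Complex s (Im z)) has_vector_derivative 1) (at (Re z))"
    unfolding Complex_eq by (auto intro!: derivative_eq_intros)
  from field_vector_diff_chain_at[OF this, of f f'] 
  show "((\<lambda>s. f (Complex s (Im z))) has_vector_derivative f') (at (Re z))"
    using assms by (simp add: o_def)
  have "((\<lambda>t. Complex (Re z) t) has_vector_derivative \<i>) (at (Im z))"
    unfolding Complex_eq by (auto intro!: derivative_eq_intros)
  from field_vector_diff_chain_at[OF this, of f f'] 
  show "((\<lambda>t. f (Complex (Re z) t)) has_vector_derivative \<i> * f') (at (Im z))"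
    using assms by (simp add: o_def)
qed

lemma has_real_derivative_inner:
  fixes f g :: "real \<Rightarrow> complex"
  assumes "(f has_vector_derivative f') (at x)" "(g has_vector_derivative g') (at x)"
  shows "((\<lambda>s. f s \<bullet> g s) has_real_derivative f' \<bullet> g x + f x \<bullet> g') (at x)"
proof -
  have "((\<lambda>s. f s \<bullet> g s) has_derivative (\<lambda>h. f x \<bullet> (h *\<^sub>R g') + (h *\<^sub>R f') \<bullet> g x)) (at x)"
    using assms unfolding has_vector_derivative_def by (rule has_derivative_inner)
  then show ?thesis
    by (rule has_derivative_imp_has_field_derivative) (simp add: algebra_simps)
qed

text \<open>
  The height and its first partial derivatives are all inner products of holomorphic functions,
  so allowing two different factors \<open>f\<close> and \<open>g\<close> makes this product rule apply twice in a row.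
  The formula for \<open>k\<close> is needed on an open set because partial derivatives depend on
  the values of \<open>k\<close> on a whole segment around the point.
\<close>
lemma partials_of_inner:
  assumes S: "open S" and k: "\<And>z. z \<in> S \<Longrightarrow> k (Re z) (Im z) = f z \<bullet> g z"
    and f: "\<And>z. z \<in> S \<Longrightarrow> (f has_field_derivative f' z) (at z)"
    and g: "\<And>z. z \<in> S \<Longrightarrow> (g has_field_derivative g' z) (at z)"
    and z: "z \<in> S"
  shows "partial_x k (Re z) (Im z) = f' z \<bullet> g z + f z \<bullet> g' z"
    and "partial_y k (Re z) (Im z) = (\<i> * f' z) \<bullet> g z + f z \<bullet> (\<i> * g' z)"
proof -
  have X: "isCont (\<lambda>s. Complex s (Im z)) (Re z)" and Y: "isCont (\<lambda>t. Complex (Re z) t) (Im z)"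
    unfolding Complex_eq by (auto intro!: continuous_intros)
  have "\<forall>\<^sub>F s in nhds (Re z). Complex s (Im z) \<in> S"
    using X S z by (simp add: continuous_within tendsto_def eventually_nhds_conv_at)
  then have "\<forall>\<^sub>F s in nhds (Re z). k s (Im z) = f (Complex s (Im z)) \<bullet> g (Complex s (Im z))"
    by eventually_elim (metis k complex.sel)
  then have "partial_x k (Re z) (Im z)
      = deriv (\<lambda>s. f (Complex s (Im z)) \<bullet> g (Complex s (Im z))) (Re z)"
    unfolding partial_x_def by (rule deriv_cong_ev) simp
  also have "\<dots> = f' z \<bullet> g z + f z \<bullet> g' z"
    using has_real_derivative_inner[OF has_vector_derivative_along_lines(1)[OF f[OF z]]
        has_vector_derivative_along_lines(1)[OF g[OF z]]]
    by (simp add: DERIV_imp_deriv)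
  finally show "partial_x k (Re z) (Im z) = f' z \<bullet> g z + f z \<bullet> g' z" .
  have "\<forall>\<^sub>F t in nhds (Im z). Complex (Re z) t \<in> S"
    using Y S z by (simp add: continuous_within tendsto_def eventually_nhds_conv_at)
  then have "\<forall>\<^sub>F t in nhds (Im z). k (Re z) t = f (Complex (Re z) t) \<bullet> g (Complex (Re z) t)"
    by eventually_elim (metis k complex.sel)
  then have "partial_y k (Re z) (Im z)
      = deriv (\<lambda>t. f (Complex (Re z) t) \<bullet> g (Complex (Re z) t)) (Im z)"
    unfolding partial_y_def by (rule deriv_cong_ev) simp
  also have "\<dots> = (\<i> * f' z) \<bullet> g z + f z \<bullet> (\<i> * g' z)"
    using has_real_derivative_inner[OF has_vector_derivative_along_lines(2)[OF f[OF z]]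
        has_vector_derivative_along_lines(2)[OF g[OF z]]]
    by (simp add: DERIV_imp_deriv)
  finally show "partial_y k (Re z) (Im z) = (\<i> * f' z) \<bullet> g z + f z \<bullet> (\<i> * g' z)" .
qed

text \<open>
  The Hessian of \<open>G \<bullet> G\<close> is the sum of \<open>2 \<bar>G'\<bar>\<^sup>2\<close> times the identity and a traceless symmetric
  matrix with entries \<open>\<plusminus> 2 (G'' \<bullet> G)\<close> and \<open>2 (\<i> G'' \<bullet> G)\<close>, hence its determinant is
  \<open>4 (\<bar>G'\<bar>\<^sup>4 - \<bar>G G''\<bar>\<^sup>2)\<close>; the gradient has square length \<open>4 \<bar>G G'\<bar>\<^sup>2\<close>.
\<close>
lemma modular_curvature_square:
  assumes S: "open S" and hol: "G holomorphic_on S"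
    and F: "\<And>z. z \<in> S \<Longrightarrow> F z = (G z)\<^sup>2" and z: "z \<in> S"
  shows "modular_curvature F z =
    4 * ((cmod (G z * deriv (deriv G) z))\<^sup>2 - (cmod (deriv G z)) ^ 4)
      / (1 - 4 * (cmod (G z * deriv G z))\<^sup>2)\<^sup>2"
proof -
  define h where "h = modular_height F"
  let ?G' = "deriv G" and ?G'' = "deriv (deriv G)"
  have G: "(G has_field_derivative ?G' w) (at w)" if "w \<in> S" for w
    using hol S that by (rule holomorphic_derivI)
  have G': "(?G' has_field_derivative ?G'' w) (at w)" if "w \<in> S" for w
    using holomorphic_deriv[OF hol S] S that by (rule holomorphic_derivI)
  have h: "h (Re w) (Im w) = G w \<bullet> G w" if "w \<in> S" for w
    using F[OF that] by (simp add: h_def modular_height_def norm_power dot_square_norm)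
  have hx: "partial_x h (Re w) (Im w) = (2 * ?G' w) \<bullet> G w"
    and hy: "partial_y h (Re w) (Im w) = (2 * \<i> * ?G' w) \<bullet> G w" if "w \<in> S" for w
    using partials_of_inner[of S h G G ?G' ?G', OF S h G G that]
    by (simp_all add: inner_complex_def algebra_simps)
  have D: "((\<lambda>w. c * ?G' w) has_field_derivative c * ?G'' w) (at w)" if "w \<in> S" for w c
    using G'[OF that] by (rule DERIV_cmult)
  have xx: "partial_x (partial_x h) (Re z) (Im z) = (2 * ?G'' z) \<bullet> G z + (2 * ?G' z) \<bullet> ?G' z"
    and xy: "partial_y (partial_x h) (Re z) (Im z)
      = (\<i> * (2 * ?G'' z)) \<bullet> G z + (2 * ?G' z) \<bullet> (\<i> * ?G' z)"
    by (rule partials_of_inner[OF S hx D G z]; assumption)+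
  have yy: "partial_y (partial_y h) (Re z) (Im z)
      = (\<i> * (2 * \<i> * ?G'' z)) \<bullet> G z + (2 * \<i> * ?G' z) \<bullet> (\<i> * ?G' z)"
    by (rule partials_of_inner[OF S hy D G z]; assumption)
  let ?a = "G z" and ?b = "?G' z" and ?c = "?G'' z"
  have b4: "cmod ?b ^ 4 = ((Re ?b)\<^sup>2 + (Im ?b)\<^sup>2)\<^sup>2"
    by (simp flip: cmod_power2 power_mult)
  have "partial_x (partial_x h) (Re z) (Im z) * partial_y (partial_y h) (Re z) (Im z)
        - (partial_y (partial_x h) (Re z) (Im z))\<^sup>2
      = - (4 * ((cmod (?a * ?c))\<^sup>2 - (cmod ?b) ^ 4))"
    unfolding xx xy yy
    by (simp only: norm_mult power_mult_distrib cmod_power2 inner_complex_def b4) (simp, algebra)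
  moreover have "1 - (partial_x h (Re z) (Im z))\<^sup>2 - (partial_y h (Re z) (Im z))\<^sup>2
      = 1 - 4 * (cmod (?a * ?b))\<^sup>2"
    unfolding hx[OF z] hy[OF z]
    by (simp only: norm_mult power_mult_distrib cmod_power2 inner_complex_def) (simp, algebra)
  ultimately show ?thesis
    unfolding modular_curvature_def lorentz_graph_curvature_def h_def[symmetric]
    by (simp only: minus_divide_left minus_minus)
qed

theorem proposition3p4:
  fixes F :: "complex \<Rightarrow> complex" and U :: "complex set"
  assumes "open U" and "0 \<in> U" and "F analytic_on U"
    and "F 0 \<noteq> 0" and "deriv F 0 = 0" and "deriv (deriv F) 0 \<noteq> 0"
  shows "\<exists>\<epsilon>>0. ball 0 \<epsilon> \<subseteq> U \<and> (\<forall>z\<in>ball 0 \<epsilon>. modular_curvature F z > 0)"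
proof -
  have hF: "F holomorphic_on U"
    using assms(3) by (rule analytic_imp_holomorphic)
  have "open {z \<in> U. F z \<noteq> 0}"
    using continuous_open_preimage[OF holomorphic_on_imp_continuous_on[OF hF] assms(1), of "- {0}"]
    by (simp add: vimage_def Int_def open_Compl)
  then obtain r where r: "r > 0" and sub: "ball 0 r \<subseteq> {z \<in> U. F z \<noteq> 0}"
    using assms(2,4) by (metis (mono_tags, lifting) mem_Collect_eq openE)
  define S :: "complex set" where "S = ball 0 r"
  have S: "open S" "0 \<in> S" and SU: "S \<subseteq> U" and nz: "\<And>z. z \<in> S \<Longrightarrow> F z \<noteq> 0"
    using r sub by (auto simp: S_def)
  have "contractible S"
    unfolding S_def by (intro convex_imp_contractible convex_ball)
  then obtain G where hG: "G holomorphic_on S" and FG: "\<And>z. z \<in> S \<Longrightarrow> F z = (G z)\<^sup>2"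
    using contractible_imp_holomorphic_sqrt[OF holomorphic_on_subset[OF hF SU] _ nz] by blast
  have hG': "deriv G holomorphic_on S" and hG'': "deriv (deriv G) holomorphic_on S"
    using hG S(1) by (auto intro!: holomorphic_deriv)
  have dG: "(G has_field_derivative deriv G z) (at z)"
    and dG': "(deriv G has_field_derivative deriv (deriv G) z) (at z)" if "z \<in> S" for z
    using holomorphic_derivI[OF hG S(1) that] holomorphic_derivI[OF hG' S(1) that] by auto
  have dF: "deriv F z = 2 * G z * deriv G z" if "z \<in> S" for z
  proof (rule DERIV_imp_deriv)
    have "((\<lambda>w. (G w)\<^sup>2) has_field_derivative 2 * G z * deriv G z) (at z)"
      using dG[OF that] by (auto intro!: derivative_eq_intros)
    then show "(F has_field_derivative 2 * G z * deriv G z) (at z)"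
      using S(1) that by (rule has_field_derivative_transform_within_open) (simp add: FG)
  qed
  have ddF: "deriv (deriv F) z = 2 * ((deriv G z)\<^sup>2 + G z * deriv (deriv G) z)" if "z \<in> S" for z
  proof (rule DERIV_imp_deriv)
    have "((\<lambda>w. 2 * G w * deriv G w) has_field_derivative
        2 * ((deriv G z)\<^sup>2 + G z * deriv (deriv G) z)) (at z)"
      using dG[OF that] dG'[OF that]
      by (auto intro!: derivative_eq_intros simp: power2_eq_square algebra_simps)
    then show "(deriv F has_field_derivative 2 * ((deriv G z)\<^sup>2 + G z * deriv (deriv G) z)) (at z)"
      using S(1) that by (rule has_field_derivative_transform_within_open) (simp add: dF)
  qed
  have G0: "G 0 \<noteq> 0" "deriv G 0 = 0" "deriv (deriv G) 0 \<noteq> 0"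
    using assms(4-6) FG[OF S(2)] dF[OF S(2)] ddF[OF S(2)] by auto
  define N where "N z = (cmod (G z * deriv (deriv G) z))\<^sup>2 - (cmod (deriv G z)) ^ 4" for z
  define D where "D z = 1 - 4 * (cmod (G z * deriv G z))\<^sup>2" for z
  \<comment> \<open>Taking the minimum lets a single neighbourhood serve for both positivity claims.\<close>
  have "continuous_on S (\<lambda>z. min (N z) (D z))"
    unfolding N_def D_def using hG hG' hG''
    by (intro continuous_intros holomorphic_on_imp_continuous_on)
  then have "open {z \<in> S. min (N z) (D z) > 0}"
    using continuous_open_preimage[OF _ S(1), of "\<lambda>z. min (N z) (D z)" "{0<..}"]
    by (simp add: vimage_def Int_def)
  moreover have "min (N 0) (D 0) > 0"
    using G0 by (simp add: N_def D_def)
  ultimately obtain \<epsilon> where \<epsilon>: "\<epsilon> > 0" and pos: "ball 0 \<epsilon> \<subseteq> {z \<in> S. min (N z) (D z) > 0}"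
    using S(2) by (metis (mono_tags, lifting) mem_Collect_eq openE)
  have "modular_curvature F z > 0" if "z \<in> ball 0 \<epsilon>" for z
  proof -
    have z: "z \<in> S" "N z > 0" "D z > 0"
      using pos that by auto
    have "modular_curvature F z = 4 * N z / (D z)\<^sup>2"
      unfolding N_def D_def by (rule modular_curvature_square[OF S(1) hG FG z(1)])
    then show ?thesis
      using z by simp
  qed
  then show ?thesis
    using \<epsilon> pos SU by blast
qed

end
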